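(* Let $G$ be a countably infinite discrete group, $H$ a subgroup of $G$, $(X,H,\alpha)$ a topological dynamical system and $(X_H^G,G,\alpha^{H\backslash G})$ its co-induced system. If $[G:H]<+\infty$, then $(X_H^G,G,\alpha^{H\backslash G})$ is null if and only if $(X,H,\alpha)$ is null.
   Context: A topological dynamical system (t.d.s.) $(X,G,\alpha)$ consists of a compact metric space $X$, a group $G$, and an action $(g,x)\mapsto\alpha_g(x)$ of $G$ on $X$ by homeomorphisms. Co-induced system: let $H\leq G$, let $H\backslash G$ be the set of right cosets $Hg$, and fix a section $s:H\backslash G\to G$ (so $s(\theta)\in\theta$) with $s(H)=e$. Given a t.d.s. $(X,H,\alpha)$, put $X_H^G=\prod_{\theta\in H\backslash G}X$ (functions $f:H\backslash G\to X$, product topology), with $G$-action $$\alpha^{H\backslash G}_{g_0}(f)(Hg)=\alpha_{s(Hg)g_0s(Hgg_0)^{-1}}\big(f(Hgg_0)\big).$$ Up to conjugacy of $G$-systems this does not depend on the section $s$. For an open cover $\mathcal{U}$ of $X$, $N(\mathcal{U})$ is the minimal cardinality of a subcover. For a sequence $\mathfrak{s}=\{g_i\}_{i\in\mathbb{N}}$ in $G$, $$h_{top}^{\mathfrak{s}}(\mathcal{U},G)=\limsup_{n\to\infty}\frac1n\log N\Big(\bigvee_{i=1}^n\alpha_{g_i^{-1}}(\mathcal{U})\Big),\qquad h_{top}^{\mathfrak{s}}(X,G)=\sup_{\mathcal{U}}h_{top}^{\mathfrak{s}}(\mathcal{U},G),$$ the supremum being over all open covers of $X$. A t.d.s. $(X,G,\alpha)$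 is null if $h_{top}^{\mathfrak{s}}(X,G)=0$ for every sequence $\mathfrak{s}$ in $G$. *)

theory Defs
  imports "HOL-Analysis.Analysis" "HOL-Algebra.Group_Action"
begin

text \<open>
  A system carries the topology of its compact metric space: none of the notions below depends on
  the choice of the metric, and a product of metric spaces comes with no preferred one.
  As always with \<^locale>\<open>group_action\<close>, the maps \<open>\<alpha> g\<close> are extensional on the space.
\<close>

definition tds :: "'x topology \<Rightarrow> ('g, 'm) monoid_scheme \<Rightarrow> ('g \<Rightarrow> 'x \<Rightarrow> 'x) \<Rightarrow> bool" where
  "tds X G \<alpha> \<longleftrightarrow>
     compact_space X \<and> metrizable_space X \<and>
     group_action G (topspace X) \<alpha> \<and>
     (\<forall>g\<in>carrier G. homeomorphic_map X X (\<alpha> g))"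

definition coset_section :: "('g, 'm) monoid_scheme \<Rightarrow> 'g set \<Rightarrow> ('g set \<Rightarrow> 'g) \<Rightarrow> bool" where
  "coset_section G H s \<longleftrightarrow> (\<forall>\<theta>\<in>rcosets\<^bsub>G\<^esub> H. s \<theta> \<in> \<theta>) \<and> s H = \<one>\<^bsub>G\<^esub>"

definition coind_space :: "('g, 'm) monoid_scheme \<Rightarrow> 'g set \<Rightarrow> 'x topology \<Rightarrow> ('g set \<Rightarrow> 'x) topology" where
  "coind_space G H X = product_topology (\<lambda>_. X) (rcosets\<^bsub>G\<^esub> H)"

text \<open>If \<open>\<theta> = Hg\<close>, then \<open>\<theta> #> g\<^sub>0 = Hgg\<^sub>0\<close>.\<close>

definition coind_action ::
  "('g, 'm) monoid_scheme \<Rightarrow> 'g set \<Rightarrow> ('g set \<Rightarrow> 'g) \<Rightarrow> 'x topology \<Rightarrow> ('g \<Rightarrow> 'x \<Rightarrow> 'x)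
    \<Rightarrow> 'g \<Rightarrow> ('g set \<Rightarrow> 'x) \<Rightarrow> ('g set \<Rightarrow> 'x)" where
  "coind_action G H s X \<alpha> g\<^sub>0 =
     (\<lambda>f\<in>topspace (coind_space G H X). \<lambda>\<theta>\<in>rcosets\<^bsub>G\<^esub> H.
        \<alpha> (s \<theta> \<otimes>\<^bsub>G\<^esub> g\<^sub>0 \<otimes>\<^bsub>G\<^esub> inv\<^bsub>G\<^esub> (s (\<theta> #>\<^bsub>G\<^esub> g\<^sub>0))) (f (\<theta> #>\<^bsub>G\<^esub> g\<^sub>0)))"

definition open_cover :: "'x topology \<Rightarrow> 'x set set \<Rightarrow> bool" where
  "open_cover X \<U> \<longleftrightarrow> (\<forall>U\<in>\<U>. openin X U) \<and> \<Union>\<U> = topspace X"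

text \<open>Meaningful for covers that have a finite subcover, as all open covers of a compact space do.\<close>

definition min_subcover :: "'x topology \<Rightarrow> 'x set set \<Rightarrow> nat" where
  "min_subcover X \<U> = (LEAST n. \<exists>\<V>\<subseteq>\<U>. finite \<V> \<and> \<Union>\<V> = topspace X \<and> card \<V> = n)"

definition join_cover :: "'x topology \<Rightarrow> nat \<Rightarrow> (nat \<Rightarrow> 'x set set) \<Rightarrow> 'x set set" where
  "join_cover X n \<C> = {topspace X \<inter> (\<Inter>i\<in>{1..n}. A i) | A. \<forall>i\<in>{1..n}. A i \<in> \<C> i}"

text \<open>
  Sequences are indexed from \<open>1\<close>; the term \<open>n = 0\<close> does not affect the limit superior.
  For the empty space \<open>min_subcover\<close> is \<open>0\<close> and, as \<open>ln 0 = 0\<close>, all entropies are \<open>0\<close>.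
\<close>

definition seq_entropy_cover ::
  "'x topology \<Rightarrow> ('g, 'm) monoid_scheme \<Rightarrow> ('g \<Rightarrow> 'x \<Rightarrow> 'x) \<Rightarrow> (nat \<Rightarrow> 'g) \<Rightarrow> 'x set set \<Rightarrow> ereal" where
  "seq_entropy_cover X G \<alpha> \<gamma> \<U> =
     limsup (\<lambda>n. ereal (1 / real n *
       ln (real (min_subcover X (join_cover X n (\<lambda>i. (`) (\<alpha> (inv\<^bsub>G\<^esub> (\<gamma> i))) ` \<U>))))))"

definition seq_entropy ::
  "'x topology \<Rightarrow> ('g, 'm) monoid_scheme \<Rightarrow> ('g \<Rightarrow> 'x \<Rightarrow> 'x) \<Rightarrow> (nat \<Rightarrow> 'g) \<Rightarrow> ereal" where
  "seq_entropy X G \<alpha> \<gamma> = (SUP \<U>\<in>{\<U>. open_cover X \<U>}. seq_entropy_cover X G \<alpha> \<gamma> \<U>)"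

definition null_system :: "'x topology \<Rightarrow> ('g, 'm) monoid_scheme \<Rightarrow> ('g \<Rightarrow> 'x \<Rightarrow> 'x) \<Rightarrow> bool" where
  "null_system X G \<alpha> \<longleftrightarrow> (\<forall>\<gamma>. range \<gamma> \<subseteq> carrier G \<longrightarrow> seq_entropy X G \<alpha> \<gamma> = 0)"

end

theory Submission
  imports Defs
begin

text \<open>
  Evaluation at the coset \<open>H\<close> exhibits \<open>(X, H)\<close> as a factor of the co-induced system restricted to
  \<open>H\<close>, so nullness passes to \<open>X\<close>. Conversely, every open cover of the finite power of \<open>X\<close> is refined
  by the boxes with sides in one open cover \<open>\<V>\<close> of \<open>X\<close>, and for a sequence \<open>\<gamma>\<close> in \<open>G\<close> the join of
  the \<open>n\<close> translated box covers is the product over the cosets \<open>\<theta>\<close> of joins of translates of \<open>\<V>\<close>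
  along sequences \<open>\<gamma>\<^sub>\<theta>\<close> in \<open>H\<close> given by the cocycle of the section. Hence the entropy along \<open>\<gamma>\<close> is
  at most the finite sum of the entropies of \<open>X\<close> along the \<open>\<gamma>\<^sub>\<theta>\<close>.
\<close>

section \<open>Minimal subcovers, refinements and joins of covers\<close>

text \<open>Choosing for each member of \<open>\<V>\<close> a member of \<open>\<U>\<close> around
  it gives a subcover that is no larger. Openness of \<open>\<V>\<close> is not assumed, so
  projections of covers and boxes built from subcovers qualify alike.\<close>

lemma min_subcover_le_card_refinement:
  assumes "finite \<V>" and "\<Union>\<V> = topspace X" and "\<And>U. U \<in> \<U> \<Longrightarrow> U \<subseteq> topspace X"
    and "\<And>V. V \<in> \<V> \<Longrightarrow> \<exists>U\<in>\<U>. V \<subseteq> U"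
  shows "min_subcover X \<U> \<le> card \<V>"
proof -
  obtain u where u: "\<And>V. V \<in> \<V> \<Longrightarrow> u V \<in> \<U> \<and> V \<subseteq> u V"
    using assms(4) by metis
  have "\<Union>(u ` \<V>) \<subseteq> topspace X"
    using u assms(3) by blast
  moreover have "topspace X \<subseteq> \<Union>(u ` \<V>)"
    using u assms(2) by blast
  ultimately have "\<Union>(u ` \<V>) = topspace X" by (rule equalityI)
  then have "min_subcover X \<U> \<le> card (u ` \<V>)"
    unfolding min_subcover_def using u assms(1)
    by (intro Least_le exI[of _ "u ` \<V>"]) (simp add: image_subset_iff)
  then show ?thesis
    using card_image_le[OF assms(1)] le_trans by blast
qed

text \<open>Compactness makes the set under \<open>LEAST\<close> nonempty; without a finite subcover
  the value would be arbitrary.\<close>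

lemma min_subcover_attained:
  assumes "compact_space X" and "open_cover X \<U>"
  obtains \<V> where "\<V> \<subseteq> \<U>" "finite \<V>" "\<Union>\<V> = topspace X" "card \<V> = min_subcover X \<U>"
proof -
  obtain \<F> where "finite \<F>" "\<F> \<subseteq> \<U>" "topspace X \<subseteq> \<Union>\<F>"
    using assms unfolding compact_space_alt open_cover_def by (metis order_refl)
  moreover from this have "\<Union>\<F> = topspace X"
    using assms(2) unfolding open_cover_def by blast
  ultimately have "\<exists>n. \<exists>\<V>\<subseteq>\<U>. finite \<V> \<and> \<Union>\<V> = topspace X \<and> card \<V> = n"
    by blast
  from LeastI_ex[OF this] that show thesis
    unfolding min_subcover_def by blast
qed

lemma open_cover_join_cover:
  assumes "\<And>i. i \<in> {1..n} \<Longrightarrow> open_cover X (\<C> i)"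
  shows "open_cover X (join_cover X n \<C>)"
  unfolding open_cover_def
proof (intro conjI ballI equalityI subsetI)
  fix W assume "W \<in> join_cover X n \<C>"
  then obtain A where A: "W = topspace X \<inter> (\<Inter>i\<in>{1..n}. A i)" "\<forall>i\<in>{1..n}. A i \<in> \<C> i"
    unfolding join_cover_def by blast
  have "openin X (topspace X \<inter> (\<Inter>i\<in>{1..n}. A i))"
  \<comment> \<open>For \<open>n = 0\<close> the intersection is \<open>UNIV\<close>, which is not
    open in \<open>X\<close> in general; only the factor \<open>topspace X\<close> saves the
    claim.\<close>
  proof (cases "{1..n} = {}")
    case False
    then show ?thesis
      using A(2) assms by (intro openin_Int openin_INT2) (auto simp: open_cover_def)
  qed auto
  then show "openin X W" using A by simp
next
  fix x assume "x \<in> \<Union>(join_cover X n \<C>)"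
  then show "x \<in> topspace X" unfolding join_cover_def by blast
next
  fix x assume x: "x \<in> topspace X"
  then have "\<forall>i\<in>{1..n}. \<exists>A\<in>\<C> i. x \<in> A"
    using assms unfolding open_cover_def by blast
  then obtain A where "\<forall>i\<in>{1..n}. A i \<in> \<C> i \<and> x \<in> A i" by metis
  then show "x \<in> \<Union>(join_cover X n \<C>)"
    using x unfolding join_cover_def by blast
qed

text \<open>A join of translated covers is indexed by translated sets; this recovers, by choice, the
  untranslated sets behind them.\<close>

lemma join_cover_imageE:
  assumes "W \<in> join_cover X n (\<lambda>i. F i ` \<C> i)"
  obtains A where "\<forall>i\<in>{1..n}. A i \<in> \<C> i" "W = topspace X \<inter> (\<Inter>i\<in>{1..n}. F i (A i))"
proof -
  obtain B where B: "W = topspace X \<inter> (\<Inter>i\<in>{1..n}. B i)" "\<forall>i\<in>{1..n}. B i \<in> F i ` \<C> i"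
    using assms unfolding join_cover_def by blast
  from B(2) have "\<forall>i\<in>{1..n}. \<exists>A. A \<in> \<C> i \<and> B i = F i A" by blast
  then obtain A where "\<forall>i\<in>{1..n}. A i \<in> \<C> i \<and> B i = F i (A i)" by (rule bchoice[THEN exE])
  with B(1) show thesis by (intro that[of A]) simp_all
qed

lemma open_cover_homeomorphic_image:
  assumes "homeomorphic_map X X f" and "open_cover X \<U>"
  shows "open_cover X ((`) f ` \<U>)"
proof -
  have "\<Union>((`) f ` \<U>) = f ` \<Union>\<U>" by blast
  then show ?thesis
    using assms homeomorphic_imp_surjective_map[OF assms(1)] homeomorphic_imp_open_map[OF assms(1)]
    unfolding open_cover_def open_map_def by auto
qed

section \<open>Logarithms of cardinalities and nullness as convergence\<close>

lemma ln_real_of_nat_nonneg: "0 \<le> ln (real n)"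
  by (cases "n = 0") auto

text \<open>Holds also for \<open>m = 0\<close>, because \<open>ln 0 = 0\<close> and the right-hand
  side is nonnegative.\<close>

lemma ln_real_of_nat_mono: "m \<le> n \<Longrightarrow> ln (real m) \<le> ln (real n)"
  using ln_real_of_nat_nonneg[of n] by (cases "m = 0") auto

text \<open>Some factor may vanish, in which case the left-hand side is \<open>ln 0 = 0\<close>.\<close>

lemma ln_real_of_nat_prod_le:
  assumes "finite I"
  shows "ln (real (\<Prod>i\<in>I. f i)) \<le> (\<Sum>i\<in>I. ln (real (f i)))"
proof (cases "\<forall>i\<in>I. f i > 0")
  case True
  then show ?thesis by (simp add: ln_prod[OF assms])
next
  case False
  then have "(\<Prod>i\<in>I. f i) = 0" using assms by auto
  then show ?thesis by (simp only:) (simp add: sum_nonneg ln_real_of_nat_nonneg)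
qed

lemma tendsto_zero_of_le_nonneg:
  fixes a b :: "nat \<Rightarrow> real"
  assumes "b \<longlonglongrightarrow> 0" and "\<And>n. a n \<le> b n" and "\<And>n. 0 \<le> a n"
  shows "a \<longlonglongrightarrow> 0"
  using assms by (intro tendsto_sandwich[of "\<lambda>_. 0" a sequentially b]) auto

lemma seq_entropy_cover_nonneg: "0 \<le> seq_entropy_cover X G \<alpha> \<gamma> \<U>"
  unfolding seq_entropy_cover_def
  by (rule le_Limsup) (auto intro!: always_eventually divide_nonneg_nonneg ln_real_of_nat_nonneg)

text \<open>All terms are nonnegative, so the limit inferior is at least \<open>0\<close> and a
  limit superior equal to \<open>0\<close> already means convergence. This replaces suprema and
  \<open>ereal\<close> limits by real limits, which can be compared and summed.\<close>

lemma null_system_iff_tendsto: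
  "null_system X G \<alpha> \<longleftrightarrow>
    (\<forall>\<gamma> \<U>. range \<gamma> \<subseteq> carrier G \<longrightarrow> open_cover X \<U> \<longrightarrow>
      (\<lambda>n. 1 / real n *
        ln (real (min_subcover X (join_cover X n (\<lambda>i. (`) (\<alpha> (inv\<^bsub>G\<^esub> (\<gamma> i))) ` \<U>)))))
      \<longlonglongrightarrow> 0)"
proof -
  \<comment> \<open>The supremum must range over a nonempty set of covers: an empty one would be
    \<open>-\<infinity>\<close> and not \<open>0\<close>.\<close>
  have ex: "open_cover X {topspace X}"
    unfolding open_cover_def by simp
  have sup: "seq_entropy X G \<alpha> \<gamma> = 0 \<longleftrightarrow>
      (\<forall>\<U>. open_cover X \<U> \<longrightarrow> seq_entropy_cover X G \<alpha> \<gamma> \<U> = 0)" for \<gamma>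
  proof
    assume "seq_entropy X G \<alpha> \<gamma> = 0"
    then show "\<forall>\<U>. open_cover X \<U> \<longrightarrow> seq_entropy_cover X G \<alpha> \<gamma> \<U> = 0"
      unfolding seq_entropy_def
      by (metis SUP_upper antisym mem_Collect_eq seq_entropy_cover_nonneg)
  next
    assume "\<forall>\<U>. open_cover X \<U> \<longrightarrow> seq_entropy_cover X G \<alpha> \<gamma> \<U> = 0"
    then show "seq_entropy X G \<alpha> \<gamma> = 0"
      unfolding seq_entropy_def using ex by (intro SUP_eq_const) auto
  qed
  have lim: "limsup (\<lambda>n. ereal (a n)) = 0 \<longleftrightarrow> a \<longlonglongrightarrow> 0" if "\<And>n. 0 \<le> a n" for a
  proof
    assume "limsup (\<lambda>n. ereal (a n)) = 0"
    moreover have "0 \<le> liminf (\<lambda>n. ereal (a n))"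
      using that by (intro Liminf_bounded always_eventually) auto
    moreover have "liminf (\<lambda>n. ereal (a n)) \<le> limsup (\<lambda>n. ereal (a n))"
      by (intro Liminf_le_Limsup) simp
    ultimately have "(\<lambda>n. ereal (a n)) \<longlonglongrightarrow> 0"
      by (intro tendsto_iff_Liminf_eq_Limsup[THEN iffD2]) auto
    then show "a \<longlonglongrightarrow> 0" by (simp add: zero_ereal_def)
  next
    assume "a \<longlonglongrightarrow> 0"
    then have "(\<lambda>n. ereal (a n)) \<longlonglongrightarrow> 0" by (simp add: zero_ereal_def)
    then show "limsup (\<lambda>n. ereal (a n)) = 0" by (intro lim_imp_Limsup) auto
  qed
  show ?thesis
    unfolding null_system_def sup seq_entropy_cover_def
    by (subst lim) (auto intro!: divide_nonneg_nonneg ln_real_of_nat_nonneg)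
qed

section \<open>Refining open covers of a finite power by boxes\<close>

text \<open>A Lebesgue number argument: the members of the cover can be taken to be balls of one radius.\<close>

lemma product_cover_refinement:
  assumes X: "compact_space X" "metrizable_space X" and I: "finite I"
    and \<U>: "open_cover (product_topology (\<lambda>_. X) I) \<U>"
  obtains \<V> where "open_cover X \<V>"
    "\<And>B. (\<And>\<theta>. \<theta> \<in> I \<Longrightarrow> B \<theta> \<in> \<V>) \<Longrightarrow> \<exists>U\<in>\<U>. (\<Pi>\<^sub>E \<theta>\<in>I. B \<theta>) \<subseteq> U"
proof -
  let ?Y = "product_topology (\<lambda>_. X) I"
  obtain M d where "Metric_space M d" and Xd: "X = Metric_space.mtopology M d"
    using X(2) unfolding metrizable_space_def by blast
  interpret Metric_space M d by fact
  have top: "topspace X = M" by (simp add: Xd)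
  \<comment> \<open>The factor 2 leaves room for the triangle inequality: a ball of radius at most
    \<open>r\<close> whose centre is within \<open>r\<close> of \<open>f \<theta>\<close> still
    fits.\<close>
  have "\<exists>r>0. \<exists>U\<in>\<U>. (\<Pi>\<^sub>E \<theta>\<in>I. mball (f \<theta>) (2 * r)) \<subseteq> U" if f: "f \<in> topspace ?Y" for f
  proof -
    obtain U where U: "U \<in> \<U>" "f \<in> U" "openin ?Y U"
      using \<U> f unfolding open_cover_def by blast
    then obtain W where W: "\<And>\<theta>. \<theta> \<in> I \<Longrightarrow> openin X (W \<theta>)" "f \<in> Pi\<^sub>E I W" "Pi\<^sub>E I W \<subseteq> U"
      unfolding openin_product_topology_alt by meson
    have "\<exists>r>0. mball (f \<theta>) r \<subseteq> W \<theta>" if "\<theta> \<in> I" for \<theta>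
      using W(1)[OF that] W(2) that unfolding Xd openin_mtopology by blast
    then obtain r where r: "\<And>\<theta>. \<theta> \<in> I \<Longrightarrow> r \<theta> > 0 \<and> mball (f \<theta>) (r \<theta>) \<subseteq> W \<theta>"
      by metis
    \<comment> \<open>Inserting 1 keeps the minimum meaningful and positive when \<open>I\<close> is
      empty; the same device serves below for an empty \<open>F\<close>.\<close>
    define \<rho> where "\<rho> = Min (insert 1 (r ` I))"
    have "\<rho> > 0" and le: "\<And>\<theta>. \<theta> \<in> I \<Longrightarrow> \<rho> \<le> r \<theta>"
      unfolding \<rho>_def using I r by auto
    have "(\<Pi>\<^sub>E \<theta>\<in>I. mball (f \<theta>) (2 * (\<rho> / 2))) \<subseteq> Pi\<^sub>E I W"
      using r le mball_subset_concentric by (intro PiE_mono) fastforce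
    then have "(\<Pi>\<^sub>E \<theta>\<in>I. mball (f \<theta>) (2 * (\<rho> / 2))) \<subseteq> U"
      using W(3) by (rule order_trans)
    with U(1) \<open>\<rho> > 0\<close> show ?thesis
      by (meson half_gt_zero)
  qed
  then obtain r where r: "\<And>f. f \<in> topspace ?Y \<Longrightarrow>
      r f > 0 \<and> (\<exists>U\<in>\<U>. (\<Pi>\<^sub>E \<theta>\<in>I. mball (f \<theta>) (2 * r f)) \<subseteq> U)"
    by metis
  let ?b = "\<lambda>f. \<Pi>\<^sub>E \<theta>\<in>I. mball (f \<theta>) (r f)"
  have "compact_space ?Y"
    using X(1) by (simp add: compact_space_product_topology)
  moreover have "\<forall>B\<in>?b ` topspace ?Y. openin ?Y B"
    using I by (auto simp: openin_PiE_gen Xd)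
  moreover have "topspace ?Y \<subseteq> \<Union>(?b ` topspace ?Y)"
  proof
    fix f assume f: "f \<in> topspace ?Y"
    then have "f \<in> ?b f" using r[OF f] by (simp add: PiE_iff top)
    with f show "f \<in> \<Union>(?b ` topspace ?Y)" by blast
  qed
  ultimately obtain \<F> where \<F>: "finite \<F>" "\<F> \<subseteq> ?b ` topspace ?Y" "topspace ?Y \<subseteq> \<Union>\<F>"
    unfolding compact_space_alt by meson
  then obtain F where F: "finite F" "F \<subseteq> topspace ?Y" "\<F> = ?b ` F"
    by (meson finite_subset_image)
  define \<rho> where "\<rho> = Min (insert 1 (r ` F))"
  have \<rho>: "\<rho> > 0" "\<And>f. f \<in> F \<Longrightarrow> \<rho> \<le> r f"
    unfolding \<rho>_def using F r by auto
  define \<V> where "\<V> = (\<lambda>x. mball x \<rho>) ` M"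
  have "open_cover X \<V>"
    using \<rho>(1) unfolding open_cover_def \<V>_def by (auto simp: Xd)
  moreover have "\<exists>U\<in>\<U>. (\<Pi>\<^sub>E \<theta>\<in>I. B \<theta>) \<subseteq> U" if "\<And>\<theta>. \<theta> \<in> I \<Longrightarrow> B \<theta> \<in> \<V>" for B
  proof -
    have "\<forall>\<theta>\<in>I. \<exists>y. y \<in> M \<and> B \<theta> = mball y \<rho>"
      using that unfolding \<V>_def by blast
    then obtain x where x: "\<And>\<theta>. \<theta> \<in> I \<Longrightarrow> x \<theta> \<in> M \<and> B \<theta> = mball (x \<theta>) \<rho>"
      by metis
    \<comment> \<open>The centres of the sides form one point of the product, and the box of the
      finite subcover containing it controls all sides at once.\<close>
    have "restrict x I \<in> topspace ?Y"
      using x by (auto simp: top)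
    then obtain f where f: "f \<in> F" "restrict x I \<in> ?b f"
      using \<F>(3) F(3) by blast
    have "B \<theta> \<subseteq> mball (f \<theta>) (2 * r f)" if "\<theta> \<in> I" for \<theta>
    proof -
      have "d (f \<theta>) (x \<theta>) < r f" "f \<theta> \<in> M"
        using f(2) that by (auto simp: PiE_iff)
      then have "mball (x \<theta>) \<rho> \<subseteq> mball (f \<theta>) (2 * r f)"
        using \<rho>(2)[OF f(1)] x[OF that] by (intro mball_subset) (auto simp: commute)
      then show ?thesis using x[OF that] by simp
    qed
    then have "Pi\<^sub>E I B \<subseteq> (\<Pi>\<^sub>E \<theta>\<in>I. mball (f \<theta>) (2 * r f))"
      by (intro PiE_mono)
    moreover obtain U where "U \<in> \<U>" "(\<Pi>\<^sub>E \<theta>\<in>I. mball (f \<theta>) (2 * r f)) \<subseteq> U"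
      using r[of f] f(1) F(2) by auto
    ultimately show ?thesis by (meson order_trans)
  qed
  ultimately show thesis using that by blast
qed


section \<open>The co-induced action and its cocycle\<close>

locale coinduced_system = group G for G (structure) +
  fixes H :: "'a set" and X :: "'x topology" and \<alpha> :: "'a \<Rightarrow> 'x \<Rightarrow> 'x" and s :: "'a set \<Rightarrow> 'a"
  assumes subgroup_H: "subgroup H G"
    and tds_H: "tds X (G\<lparr>carrier := H\<rparr>) \<alpha>"
    and section_s: "coset_section G H s"
begin

abbreviation Y :: "('a set \<Rightarrow> 'x) topology" where "Y \<equiv> coind_space G H X"

abbreviation \<beta> :: "'a \<Rightarrow> ('a set \<Rightarrow> 'x) \<Rightarrow> 'a set \<Rightarrow> 'x" where
  "\<beta> \<equiv> coind_action G H s X \<alpha>"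

text \<open>The cocycle of right translation on the cosets that belongs to the section: it measures
  how \<open>s \<theta> \<otimes> g\<close> differs from the representative of its coset, \<open>s
  \<theta> \<otimes> g = cocycle \<theta> g \<otimes> s (\<theta> #> g)\<close>.\<close>

definition cocycle :: "'a set \<Rightarrow> 'a \<Rightarrow> 'a" where
  "cocycle \<theta> g = s \<theta> \<otimes> g \<otimes> inv (s (\<theta> #> g))"

sublocale H: group_action "G\<lparr>carrier := H\<rparr>" "topspace X" \<alpha>
  using tds_H unfolding tds_def by blast

lemma H_subset: "H \<subseteq> carrier G"
  using subgroup_H by (rule subgroup.subset)

lemma compact_X: "compact_space X"
  using tds_H unfolding tds_def by blast

lemma compact_Y: "compact_space Y"
  using compact_X by (simp add: coind_space_def compact_space_product_topology)

lemma topspace_Y: "topspace Y = (\<Pi>\<^sub>E \<theta>\<in>rcosets H. topspace X)"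
  by (simp add: coind_space_def)

lemma open_cover_\<alpha>_image: "h \<in> H \<Longrightarrow> open_cover X \<U> \<Longrightarrow> open_cover X ((`) (\<alpha> h) ` \<U>)"
  using tds_H by (auto simp: tds_def intro: open_cover_homeomorphic_image)

lemma \<alpha>_closed: "h \<in> H \<Longrightarrow> x \<in> topspace X \<Longrightarrow> \<alpha> h x \<in> topspace X"
  using H.element_image[of h x] by simp

lemma \<alpha>_mult: "h \<in> H \<Longrightarrow> k \<in> H \<Longrightarrow> x \<in> topspace X \<Longrightarrow> \<alpha> (h \<otimes> k) x = \<alpha> h (\<alpha> k x)"
  using H.composition_rule[of x h k] by simp

lemma \<alpha>_one: "x \<in> topspace X \<Longrightarrow> \<alpha> \<one> x = x"
  using fun_cong[OF H.id_eq_one, of x] by simp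

lemma \<alpha>_inv_right: "h \<in> H \<Longrightarrow> x \<in> topspace X \<Longrightarrow> \<alpha> h (\<alpha> (inv h) x) = x"
  using \<alpha>_mult[of h "inv h" x] \<alpha>_one[of x] subsetD[OF H_subset, of h]
    subgroup.m_inv_closed[OF subgroup_H, of h]
  by simp

lemma H_in_rcosets: "H \<in> rcosets H"
  using subgroup.subgroup_in_rcosets[OF subgroup_H is_group] .

lemma rcoset_mult_closed: "\<theta> \<in> rcosets H \<Longrightarrow> g \<in> carrier G \<Longrightarrow> \<theta> #> g \<in> rcosets H"
  unfolding RCOSETS_def using H_subset by (auto simp: coset_mult_assoc)

lemma rcoset_subset: "\<theta> \<in> rcosets H \<Longrightarrow> \<theta> \<subseteq> carrier G"
  using rcosets_part_G[OF subgroup_H] by blast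

lemma s_closed: "\<theta> \<in> rcosets H \<Longrightarrow> s \<theta> \<in> carrier G"
  using section_s rcoset_subset unfolding coset_section_def by blast

lemma inv_mult_cancel: "x \<in> carrier G \<Longrightarrow> y \<in> carrier G \<Longrightarrow> inv x \<otimes> (x \<otimes> y) = y"
  by (simp flip: m_assoc)

lemma rcoset_mult_inv_cancel:
  assumes "\<theta> \<in> rcosets H" and "g \<in> carrier G"
  shows "\<theta> #> g #> inv g = \<theta>" and "\<theta> #> inv g #> g = \<theta>"
  using assms rcoset_subset[OF assms(1)] by (simp_all add: coset_mult_assoc)

text \<open>Both \<open>s \<theta> \<otimes> g\<close> and \<open>s (\<theta> #> g)\<close>
  represent the coset \<open>\<theta> #> g\<close>, so their quotient is in
  \<open>H\<close>.\<close>

lemma cocycle_closed: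
  assumes "\<theta> \<in> rcosets H" and "g \<in> carrier G"
  shows "cocycle \<theta> g \<in> H"
proof -
  have \<theta>g: "\<theta> #> g \<in> rcosets H" using assms by (rule rcoset_mult_closed)
  then obtain a where a: "a \<in> carrier G" "\<theta> #> g = H #> a"
    unfolding RCOSETS_def by blast
  have "s (\<theta> #> g) \<in> \<theta> #> g" "s \<theta> \<in> \<theta>"
    using section_s assms(1) \<theta>g unfolding coset_section_def by auto
  then have "s (\<theta> #> g) \<in> H #> a" "s \<theta> \<otimes> g \<in> H #> a"
    using rcosI[OF _ rcoset_subset[OF assms(1)] assms(2)] by (simp_all flip: a(2))
  then have "s \<theta> \<otimes> g \<in> H #> s (\<theta> #> g)"
    using repr_independence[OF _ a(1) subgroup_H] by blast
  then show ?thesis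
    unfolding cocycle_def
    using subgroup.rcos_module_imp[OF subgroup_H is_group s_closed[OF \<theta>g]] by blast
qed

text \<open>The cocycle identity for \<open>inv g\<close> followed by \<open>g\<close>: the two
  occurrences of \<open>s (\<theta> #> inv g)\<close> cancel.\<close>

lemma cocycle_inv:
  assumes "\<theta> \<in> rcosets H" and "g \<in> carrier G"
  shows "cocycle \<theta> (inv g) \<otimes> cocycle (\<theta> #> inv g) g = \<one>"
proof -
  have "s \<theta> \<in> carrier G" "s (\<theta> #> inv g) \<in> carrier G"
    using assms by (auto intro!: s_closed rcoset_mult_closed)
  then show ?thesis
    using assms unfolding cocycle_def
    by (simp add: rcoset_mult_inv_cancel m_assoc inv_mult_cancel)
qed

text \<open>The normalisation \<open>s H = \<one>\<close> enters here; it makes evaluation at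
  \<open>H\<close> equivariant on the nose.\<close>

lemma cocycle_H: "h \<in> H \<Longrightarrow> cocycle H h = h"
  using section_s subgroup.rcos_const[OF subgroup_H is_group] H_subset
  unfolding cocycle_def coset_section_def by auto

lemma \<beta>_apply:
  "f \<in> topspace Y \<Longrightarrow> \<theta> \<in> rcosets H \<Longrightarrow> \<beta> g f \<theta> = \<alpha> (cocycle \<theta> g) (f (\<theta> #> g))"
  by (simp add: coind_action_def cocycle_def)

lemma \<beta>_closed:
  assumes "f \<in> topspace Y" and "g \<in> carrier G"
  shows "\<beta> g f \<in> topspace Y"
proof -
  have "\<beta> g f \<theta> \<in> topspace X" if "\<theta> \<in> rcosets H" for \<theta>
    using assms that cocycle_closed[OF that assms(2)] rcoset_mult_closed[OF that assms(2)]
    by (auto simp: \<beta>_apply topspace_Y intro!: \<alpha>_closed)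
  moreover have "\<beta> g f \<in> extensional (rcosets H)"
    using assms(1) by (simp add: coind_action_def)
  ultimately show ?thesis
    by (auto simp: topspace_Y PiE_iff)
qed

text \<open>The part of the action law that the bounds rest on: \<open>f\<close> lies in the image
  of a set under \<open>\<beta> (inv g)\<close> as soon as \<open>\<beta> g f\<close> lies in the
  set.\<close>

lemma \<beta>_inv_cancel:
  assumes f: "f \<in> topspace Y" and g: "g \<in> carrier G"
  shows "\<beta> (inv g) (\<beta> g f) = f"
proof (rule extensionalityI[of _ "rcosets H"])
  show "\<beta> (inv g) (\<beta> g f) \<in> extensional (rcosets H)" "f \<in> extensional (rcosets H)"
    using \<beta>_closed[OF \<beta>_closed[OF f g] inv_closed[OF g]] f by (auto simp: topspace_Y PiE_iff)
next
  fix \<theta> assume \<theta>: "\<theta> \<in> rcosets H"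
  have \<theta>': "\<theta> #> inv g \<in> rcosets H" using \<theta> g by (simp add: rcoset_mult_closed)
  have f\<theta>: "f \<theta> \<in> topspace X" using f \<theta> by (auto simp: topspace_Y)
  have "\<beta> (inv g) (\<beta> g f) \<theta> = \<alpha> (cocycle \<theta> (inv g)) (\<alpha> (cocycle (\<theta> #> inv g) g) (f \<theta>))"
    using f g \<theta> \<theta>' \<beta>_closed[OF f g] by (simp add: \<beta>_apply rcoset_mult_inv_cancel)
  also have "\<dots> = f \<theta>"
    using \<alpha>_mult[OF cocycle_closed[OF \<theta> inv_closed[OF g]] cocycle_closed[OF \<theta>' g] f\<theta>]
      cocycle_inv[OF \<theta> g] \<alpha>_one[OF f\<theta>] by simp
  finally show "\<beta> (inv g) (\<beta> g f) \<theta> = f \<theta>" .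
qed

lemma inv_in_H: "h \<in> H \<Longrightarrow> inv h \<in> H"
  using subgroup.m_inv_closed[OF subgroup_H] .

lemma inv_restrict_H: "h \<in> H \<Longrightarrow> inv\<^bsub>G\<lparr>carrier := H\<rparr>\<^esub> h = inv h"
  using m_inv_consistent[OF subgroup_H] by simp

section \<open>Evaluation at the coset \<open>H\<close> as a factor map\<close>

text \<open>Equivariance of evaluation under \<open>H\<close>, in the form needed for covers:
  translating and pulling back commute.\<close>

lemma \<beta>_image_evaluation_vimage:
  assumes h: "h \<in> H" and U: "U \<subseteq> topspace X"
  shows "\<beta> (inv h) ` {f \<in> topspace Y. f H \<in> U} = {f \<in> topspace Y. f H \<in> \<alpha> (inv h) ` U}"
proof -
  have hG: "h \<in> carrier G" using h H_subset by blast
  have ev: "\<beta> k f H = \<alpha> k (f H)" if "k \<in> H" "f \<in> topspace Y" for k f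
    using that by (simp add: \<beta>_apply H_in_rcosets cocycle_H subgroup.rcos_const[OF subgroup_H is_group])
  show ?thesis
  proof (intro equalityI subsetI)
    fix f assume "f \<in> \<beta> (inv h) ` {f \<in> topspace Y. f H \<in> U}"
    then show "f \<in> {f \<in> topspace Y. f H \<in> \<alpha> (inv h) ` U}"
      using ev[OF inv_in_H[OF h]] \<beta>_closed[OF _ inv_closed[OF hG]] by auto
  next
    fix f assume "f \<in> {f \<in> topspace Y. f H \<in> \<alpha> (inv h) ` U}"
    then obtain u where f: "f \<in> topspace Y" "u \<in> U" "f H = \<alpha> (inv h) u" by blast
    then have "\<beta> h f H = u"
      using ev[OF h] \<alpha>_inv_right[OF h] U by auto
    then show "f \<in> \<beta> (inv h) ` {f \<in> topspace Y. f H \<in> U}"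
      using f \<beta>_closed[OF f(1) hG] \<beta>_inv_cancel[OF f(1) hG]
      by (intro image_eqI[of _ _ "\<beta> h f"]) auto
  qed
qed

lemma open_cover_evaluation_vimage:
  assumes "open_cover X \<U>"
  shows "open_cover Y ((\<lambda>U. {f \<in> topspace Y. f H \<in> U}) ` \<U>)"
proof -
  have "continuous_map Y X (\<lambda>f. f H)"
    unfolding coind_space_def by (intro continuous_map_product_projection H_in_rcosets)
  then have "openin Y {f \<in> topspace Y. f H \<in> U}" if "U \<in> \<U>" for U
    using that assms by (auto simp: open_cover_def intro: openin_continuous_map_preimage)
  moreover have "f H \<in> \<Union>\<U>" if "f \<in> topspace Y" for f
    using that assms H_in_rcosets by (auto simp: open_cover_def topspace_Y)
  ultimately show ?thesis
    unfolding open_cover_def by blast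
qed

text \<open>An optimal subcover of the pulled-back join is projected by evaluation at
  \<open>H\<close>. Its images cover \<open>X\<close> and refine the join there, though they need
  not belong to it.\<close>

lemma min_subcover_le_coinduced:
  assumes \<gamma>: "range \<gamma> \<subseteq> H" and \<U>: "open_cover X \<U>"
  shows "min_subcover X (join_cover X n (\<lambda>i. (`) (\<alpha> (inv (\<gamma> i))) ` \<U>))
    \<le> min_subcover Y (join_cover Y n
        (\<lambda>i. (`) (\<beta> (inv (\<gamma> i))) ` (\<lambda>U. {f \<in> topspace Y. f H \<in> U}) ` \<U>))"
    (is "min_subcover X ?J \<le> min_subcover Y ?K")
proof -
  have \<gamma>': "\<gamma> i \<in> H" for i using \<gamma> by blast
  have sub: "U \<subseteq> topspace X" if "U \<in> \<U>" for U
    using \<U> that by (auto simp: open_cover_def)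
  have K: "?K = join_cover Y n
      (\<lambda>i. (\<lambda>U. {f \<in> topspace Y. f H \<in> U}) ` (`) (\<alpha> (inv (\<gamma> i))) ` \<U>)" (is "_ = join_cover Y n ?C")
    using \<beta>_image_evaluation_vimage[OF \<gamma>' sub] by (simp add: image_image cong: image_cong)
  have cov: "open_cover X ((`) (\<alpha> (inv (\<gamma> i))) ` \<U>)" for i
    by (rule open_cover_\<alpha>_image[OF inv_in_H[OF \<gamma>'] \<U>])
  have J: "open_cover X ?J"
    by (rule open_cover_join_cover) (rule cov)
  have "open_cover Y ?K"
    unfolding K by (intro open_cover_join_cover open_cover_evaluation_vimage cov)
  then obtain \<T> where \<T>: "\<T> \<subseteq> ?K" "finite \<T>" "\<Union>\<T> = topspace Y" "card \<T> = min_subcover Y ?K"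
    using min_subcover_attained[OF compact_Y] by blast
  let ?e = "\<lambda>f :: 'a set \<Rightarrow> 'x. f H"
  have "\<Union>((`) ?e ` \<T>) = topspace X"
  proof -
    have "\<Union>((`) ?e ` \<T>) = ?e ` topspace Y" using \<T>(3) by blast
    \<comment> \<open>Constant families show that evaluation is onto.\<close>
    moreover have "x \<in> ?e ` topspace Y" if "x \<in> topspace X" for x
      using that H_in_rcosets
      by (intro image_eqI[of _ _ "\<lambda>\<theta>\<in>rcosets H. x"]) (auto simp: topspace_Y)
    ultimately show ?thesis
      using H_in_rcosets by (auto simp: topspace_Y)
  qed
  moreover have "\<exists>U\<in>?J. V \<subseteq> U" if "V \<in> (`) ?e ` \<T>" for V
  proof -
    obtain T where T: "T \<in> \<T>" "V = ?e ` T" using \<open>V \<in> _\<close> by blast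
    then have "T \<in> join_cover Y n ?C" using \<T>(1) unfolding K by blast
    then obtain B where B: "\<forall>i\<in>{1..n}. B i \<in> (`) (\<alpha> (inv (\<gamma> i))) ` \<U>"
      "T = topspace Y \<inter> (\<Inter>i\<in>{1..n}. {f \<in> topspace Y. f H \<in> B i})"
      by (rule join_cover_imageE)
    have "V \<subseteq> topspace X \<inter> (\<Inter>i\<in>{1..n}. B i)"
      unfolding T(2) B(2) using H_in_rcosets by (auto simp: topspace_Y)
    moreover have "topspace X \<inter> (\<Inter>i\<in>{1..n}. B i) \<in> ?J"
      using B unfolding join_cover_def by blast
    ultimately show ?thesis by blast
  qed
  ultimately have "min_subcover X ?J \<le> card ((`) ?e ` \<T>)"
    using \<T>(2) J by (intro min_subcover_le_card_refinement) (auto simp: open_cover_def)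
  also have "\<dots> \<le> card \<T>" by (rule card_image_le[OF \<T>(2)])
  finally show ?thesis using \<T>(4) by simp
qed

section \<open>The product bound for joins of box covers\<close>

text \<open>
  The coordinates of the preimage of a box under \<open>\<beta> g\<close> are translates by inverse cocycle values of
  the sides of the box, permuted by \<open>\<theta> \<mapsto> \<theta> #> g\<close>; so a join of such preimages is a product of joins.
\<close>

lemma min_subcover_coinduced_le:
  assumes fin: "finite (rcosets H)" and \<gamma>: "range \<gamma> \<subseteq> carrier G" and \<V>: "open_cover X \<V>"
    and refine: "\<And>B. (\<And>\<theta>. \<theta> \<in> rcosets H \<Longrightarrow> B \<theta> \<in> \<V>) \<Longrightarrow> \<exists>U\<in>\<U>. Pi\<^sub>E (rcosets H) B \<subseteq> U"
  shows "min_subcover Y (join_cover Y n (\<lambda>i. (`) (\<beta> (inv (\<gamma> i))) ` \<U>))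
    \<le> (\<Prod>\<theta>\<in>rcosets H. min_subcover X (join_cover X n
        (\<lambda>i. (`) (\<alpha> (inv (cocycle (\<theta> #> inv (\<gamma> i)) (\<gamma> i)))) ` \<V>)))"
    (is "min_subcover Y ?K \<le> (\<Prod>\<theta>\<in>rcosets H. min_subcover X (?J \<theta>))")
proof -
  \<comment> \<open>By \<open>cocycle_inv\<close>, \<open>inv (?c \<theta> i)\<close> is
    \<open>cocycle \<theta> (inv (\<gamma> i))\<close>, the element by which
    \<open>\<beta> (inv (\<gamma> i))\<close> acts in coordinate \<open>\<theta>\<close>. So
    \<open>?c \<theta>\<close> is the sequence in \<open>H\<close> seen by that coordinate.\<close>
  let ?I = "rcosets H" and ?c = "\<lambda>\<theta> i. cocycle (\<theta> #> inv (\<gamma> i)) (\<gamma> i)"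
  have \<gamma>': "\<gamma> i \<in> carrier G" for i using \<gamma> by blast
  have c: "?c \<theta> i \<in> H" if "\<theta> \<in> ?I" for \<theta> i
    using that \<gamma>' by (intro cocycle_closed rcoset_mult_closed) auto
  have J: "open_cover X (?J \<theta>)" if "\<theta> \<in> ?I" for \<theta>
    using c[OF that] by (intro open_cover_join_cover open_cover_\<alpha>_image inv_in_H \<V>)
  have "\<exists>\<W>. \<W> \<subseteq> ?J \<theta> \<and> finite \<W> \<and> \<Union>\<W> = topspace X \<and> card \<W> = min_subcover X (?J \<theta>)"
    if "\<theta> \<in> ?I" for \<theta>
    by (rule min_subcover_attained[OF compact_X J[OF that]]) blast
  then have "\<exists>\<W>. \<forall>\<theta>\<in>?I.
      \<W> \<theta> \<subseteq> ?J \<theta> \<and> finite (\<W> \<theta>) \<and> \<Union>(\<W> \<theta>) = topspace X \<and> card (\<W> \<theta>) = min_subcover X (?J \<theta>)"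
    by (intro bchoice ballI)
  then obtain \<W> where \<W>: "\<And>\<theta>. \<theta> \<in> ?I \<Longrightarrow>
      \<W> \<theta> \<subseteq> ?J \<theta> \<and> finite (\<W> \<theta>) \<and> \<Union>(\<W> \<theta>) = topspace X \<and> card (\<W> \<theta>) = min_subcover X (?J \<theta>)"
    by (elim exE) (rule that, erule bspec)
  have finW: "finite (Pi\<^sub>E ?I \<W>)"
    using fin \<W> by (intro finite_PiE) auto
  \<comment> \<open>The competing cover: all boxes whose side at each \<open>\<theta>\<close> comes
    from the optimal subcover \<open>\<W> \<theta>\<close>.\<close>
  have "\<Union>(Pi\<^sub>E ?I ` Pi\<^sub>E ?I \<W>) = topspace Y"
  proof (intro equalityI subsetI)
    fix f assume "f \<in> \<Union>(Pi\<^sub>E ?I ` Pi\<^sub>E ?I \<W>)"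
    then obtain w where "f \<in> Pi\<^sub>E ?I w" "w \<in> Pi\<^sub>E ?I \<W>" by blast
    then show "f \<in> topspace Y"
      using \<W> unfolding topspace_Y PiE_iff by blast
  next
    fix f assume f: "f \<in> topspace Y"
    then have "\<forall>\<theta>\<in>?I. \<exists>w\<in>\<W> \<theta>. f \<theta> \<in> w"
      using \<W> unfolding topspace_Y by blast
    then obtain w where w: "\<forall>\<theta>\<in>?I. w \<theta> \<in> \<W> \<theta> \<and> f \<theta> \<in> w \<theta>" by metis
    then have "restrict w ?I \<in> Pi\<^sub>E ?I \<W>" "f \<in> Pi\<^sub>E ?I (restrict w ?I)"
      using f by (auto simp: topspace_Y PiE_iff)
    then show "f \<in> \<Union>(Pi\<^sub>E ?I ` Pi\<^sub>E ?I \<W>)" by blast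
  qed
  moreover have "\<exists>U\<in>?K. V \<subseteq> U" if "V \<in> Pi\<^sub>E ?I ` Pi\<^sub>E ?I \<W>" for V
  proof -
    obtain w where w: "V = Pi\<^sub>E ?I w" "w \<in> Pi\<^sub>E ?I \<W>" using \<open>V \<in> _\<close> by blast
    have "\<exists>A. (\<forall>i\<in>{1..n}. A i \<in> \<V>) \<and>
        w \<theta> \<subseteq> topspace X \<inter> (\<Inter>i\<in>{1..n}. \<alpha> (inv (?c \<theta> i)) ` A i)" if "\<theta> \<in> ?I" for \<theta>
    proof -
      have "w \<theta> \<in> ?J \<theta>" using w(2) \<W>[OF that] that by auto
      then show ?thesis by (rule join_cover_imageE) blast
    qed
    then have "\<exists>A. \<forall>\<theta>\<in>?I. (\<forall>i\<in>{1..n}. A \<theta> i \<in> \<V>) \<and>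
        w \<theta> \<subseteq> topspace X \<inter> (\<Inter>i\<in>{1..n}. \<alpha> (inv (?c \<theta> i)) ` A \<theta> i)"
      by (intro bchoice ballI)
    then obtain A where A: "\<And>\<theta> i. \<theta> \<in> ?I \<Longrightarrow> i \<in> {1..n} \<Longrightarrow> A \<theta> i \<in> \<V>"
      "\<And>\<theta>. \<theta> \<in> ?I \<Longrightarrow> w \<theta> \<subseteq> topspace X \<inter> (\<Inter>i\<in>{1..n}. \<alpha> (inv (?c \<theta> i)) ` A \<theta> i)"
      by blast
    \<comment> \<open>The index is shifted because coordinate \<open>\<theta>\<close> of
      \<open>\<beta> (\<gamma> i) f\<close> reads \<open>f\<close> at
      \<open>\<theta> #> \<gamma> i\<close>; this box is the one that will contain
      \<open>\<beta> (\<gamma> i) f\<close>.\<close>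
    have "\<exists>U\<in>\<U>. (\<Pi>\<^sub>E \<theta>\<in>?I. A (\<theta> #> \<gamma> i) i) \<subseteq> U" if "i \<in> {1..n}" for i
      using A(1) that \<gamma>' by (intro refine) (simp add: rcoset_mult_closed)
    then obtain U where U: "\<And>i. i \<in> {1..n} \<Longrightarrow> U i \<in> \<U> \<and> (\<Pi>\<^sub>E \<theta>\<in>?I. A (\<theta> #> \<gamma> i) i) \<subseteq> U i"
      by metis
    have VY: "V \<subseteq> topspace Y"
      unfolding w(1) topspace_Y using A(2) by (intro PiE_mono) blast
    have "f \<in> \<beta> (inv (\<gamma> i)) ` U i" if f: "f \<in> V" and i: "i \<in> {1..n}" for f i
    proof -
      have fY: "f \<in> topspace Y" using f VY by blast
      have "\<beta> (\<gamma> i) f \<theta> \<in> A (\<theta> #> \<gamma> i) i" if \<theta>: "\<theta> \<in> ?I" for \<theta>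
      proof -
        have \<theta>': "\<theta> #> \<gamma> i \<in> ?I" using \<theta> \<gamma>' by (rule rcoset_mult_closed)
        \<comment> \<open>At the shifted coset the translation in the join is by the inverse of
          exactly the element that \<open>\<beta> (\<gamma> i)\<close> applies, so the two
          cancel.\<close>
        have cc: "?c (\<theta> #> \<gamma> i) i = cocycle \<theta> (\<gamma> i)"
          using \<theta> \<gamma>' by (simp add: rcoset_mult_inv_cancel)
        have "f (\<theta> #> \<gamma> i) \<in> w (\<theta> #> \<gamma> i)" using f w(1) \<theta>' by auto
        then obtain a where a: "a \<in> A (\<theta> #> \<gamma> i) i" "f (\<theta> #> \<gamma> i) = \<alpha> (inv (cocycle \<theta> (\<gamma> i))) a"
          using A(2)[OF \<theta>'] i unfolding cc[symmetric] by blast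
        have "a \<in> topspace X"
          using a(1) A(1)[OF \<theta>' i] \<V> unfolding open_cover_def by blast
        then have "\<beta> (\<gamma> i) f \<theta> = a"
          using a(2) \<alpha>_inv_right[OF cocycle_closed[OF \<theta> \<gamma>']] by (simp add: \<beta>_apply[OF fY \<theta>])
        with a(1) show ?thesis by simp
      qed
      moreover have "\<beta> (\<gamma> i) f \<in> topspace Y" using fY \<gamma>' by (rule \<beta>_closed)
      ultimately have "\<beta> (\<gamma> i) f \<in> U i"
        using U[OF i] by (auto simp: topspace_Y PiE_iff subset_iff)
      then show ?thesis
        using \<beta>_inv_cancel[OF fY \<gamma>'] by (metis image_eqI)
    qed
    then have "V \<subseteq> topspace Y \<inter> (\<Inter>i\<in>{1..n}. \<beta> (inv (\<gamma> i)) ` U i)"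
      using VY by blast
    moreover have "topspace Y \<inter> (\<Inter>i\<in>{1..n}. \<beta> (inv (\<gamma> i)) ` U i) \<in> ?K"
      using U unfolding join_cover_def by blast
    ultimately show ?thesis by blast
  qed
  ultimately have "min_subcover Y ?K \<le> card (Pi\<^sub>E ?I ` Pi\<^sub>E ?I \<W>)"
    using finW by (intro min_subcover_le_card_refinement) (auto simp: join_cover_def)
  also have "\<dots> \<le> card (Pi\<^sub>E ?I \<W>)" by (rule card_image_le[OF finW])
  also have "\<dots> = (\<Prod>\<theta>\<in>?I. min_subcover X (?J \<theta>))"
    using fin \<W> by (simp add: card_PiE)
  finally show ?thesis .
qed

section \<open>Transfer of nullness in both directions\<close>

lemma null_coinduced_imp_null:
  assumes "null_system Y G \<beta>"
  shows "null_system X (G\<lparr>carrier := H\<rparr>) \<alpha>"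
  unfolding null_system_iff_tendsto
proof (intro allI impI)
  fix \<gamma> :: "nat \<Rightarrow> 'a" and \<U>
  assume "range \<gamma> \<subseteq> carrier (G\<lparr>carrier := H\<rparr>)" and \<U>: "open_cover X \<U>"
  then have \<gamma>: "range \<gamma> \<subseteq> H" by simp
  then have invs: "inv\<^bsub>G\<lparr>carrier := H\<rparr>\<^esub> (\<gamma> i) = inv (\<gamma> i)" for i
    by (intro inv_restrict_H) blast
  let ?a = "\<lambda>n. 1 / real n * ln (real (min_subcover X (join_cover X n
    (\<lambda>i. (`) (\<alpha> (inv (\<gamma> i))) ` \<U>))))"
  let ?b = "\<lambda>n. 1 / real n * ln (real (min_subcover Y (join_cover Y n
    (\<lambda>i. (`) (\<beta> (inv (\<gamma> i))) ` (\<lambda>U. {f \<in> topspace Y. f H \<in> U}) ` \<U>))))"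
  \<comment> \<open>A sequence in \<open>H\<close> is also one in \<open>G\<close>, so nullness of
    \<open>Y\<close> applies to it and the pulled-back cover.\<close>
  have "?b \<longlonglongrightarrow> 0"
    using assms \<gamma> H_subset open_cover_evaluation_vimage[OF \<U>] unfolding null_system_iff_tendsto
    by blast
  moreover have "\<And>n. ?a n \<le> ?b n"
    using min_subcover_le_coinduced[OF \<gamma> \<U>]
    by (intro mult_left_mono ln_real_of_nat_mono) auto
  moreover have "\<And>n. 0 \<le> ?a n"
    by (intro mult_nonneg_nonneg ln_real_of_nat_nonneg) auto
  ultimately have "?a \<longlonglongrightarrow> 0"
    by (rule tendsto_zero_of_le_nonneg)
  then show "(\<lambda>n. 1 / real n * ln (real (min_subcover X (join_cover X n
      (\<lambda>i. (`) (\<alpha> (inv\<^bsub>G\<lparr>carrier := H\<rparr>\<^esub> (\<gamma> i))) ` \<U>))))) \<longlonglongrightarrow> 0"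
    by (simp only: invs)
qed

lemma null_imp_null_coinduced:
  assumes fin: "finite (rcosets H)" and null: "null_system X (G\<lparr>carrier := H\<rparr>) \<alpha>"
  shows "null_system Y G \<beta>"
  unfolding null_system_iff_tendsto
proof (intro allI impI)
  fix \<gamma> :: "nat \<Rightarrow> 'a" and \<U>
  assume \<gamma>: "range \<gamma> \<subseteq> carrier G" and \<U>: "open_cover Y \<U>"
  have "metrizable_space X" using tds_H unfolding tds_def by blast
  \<comment> \<open>This cover depends on \<open>\<U>\<close> alone, so it serves every
    \<open>n\<close> and every coset; the number of factors in the product bound is fixed as
    well.\<close>
  then obtain \<V> where \<V>: "open_cover X \<V>"
    "\<And>B. (\<And>\<theta>. \<theta> \<in> rcosets H \<Longrightarrow> B \<theta> \<in> \<V>) \<Longrightarrow> \<exists>U\<in>\<U>. Pi\<^sub>E (rcosets H) B \<subseteq> U"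
    using product_cover_refinement[OF compact_X _ fin \<U>[unfolded coind_space_def]] by metis
  let ?c = "\<lambda>\<theta> i. cocycle (\<theta> #> inv (\<gamma> i)) (\<gamma> i)"
  let ?N = "\<lambda>\<theta> n. min_subcover X (join_cover X n (\<lambda>i. (`) (\<alpha> (inv (?c \<theta> i))) ` \<V>))"
  let ?M = "\<lambda>n. min_subcover Y (join_cover Y n (\<lambda>i. (`) (\<beta> (inv (\<gamma> i))) ` \<U>))"
  \<comment> \<open>Each coset contributes its own sequence in \<open>H\<close>; nullness of
    \<open>X\<close> is applied to each separately.\<close>
  have "(\<lambda>n. 1 / real n * ln (real (?N \<theta> n))) \<longlonglongrightarrow> 0" if "\<theta> \<in> rcosets H" for \<theta>
  proof -
    have c: "?c \<theta> i \<in> H" for i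
      using that \<gamma> by (intro cocycle_closed rcoset_mult_closed) auto
    then have "range (?c \<theta>) \<subseteq> carrier (G\<lparr>carrier := H\<rparr>)" by auto
    then have "(\<lambda>n. 1 / real n * ln (real (min_subcover X (join_cover X n
        (\<lambda>i. (`) (\<alpha> (inv\<^bsub>G\<lparr>carrier := H\<rparr>\<^esub> (?c \<theta> i))) ` \<V>))))) \<longlonglongrightarrow> 0"
      using null \<V>(1) unfolding null_system_iff_tendsto by blast
    then show ?thesis by (simp only: inv_restrict_H[OF c])
  qed
  then have "(\<lambda>n. \<Sum>\<theta>\<in>rcosets H. 1 / real n * ln (real (?N \<theta> n))) \<longlonglongrightarrow> 0"
    by (rule tendsto_null_sum)
  moreover have "1 / real n * ln (real (?M n)) \<le> (\<Sum>\<theta>\<in>rcosets H. 1 / real n * ln (real (?N \<theta> n)))" for n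
  proof -
    have "ln (real (?M n)) \<le> ln (real (\<Prod>\<theta>\<in>rcosets H. ?N \<theta> n))"
      by (rule ln_real_of_nat_mono[OF min_subcover_coinduced_le[OF fin \<gamma> \<V>]])
    also have "\<dots> \<le> (\<Sum>\<theta>\<in>rcosets H. ln (real (?N \<theta> n)))"
      using fin by (rule ln_real_of_nat_prod_le)
    finally have "1 / real n * ln (real (?M n)) \<le> 1 / real n * (\<Sum>\<theta>\<in>rcosets H. ln (real (?N \<theta> n)))"
      by (intro mult_left_mono) auto
    then show ?thesis by (simp only: sum_distrib_left)
  qed
  moreover have "0 \<le> 1 / real n * ln (real (?M n))" for n
    by (intro mult_nonneg_nonneg ln_real_of_nat_nonneg) auto
  ultimately show "(\<lambda>n. 1 / real n * ln (real (?M n))) \<longlonglongrightarrow> 0"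
    by (rule tendsto_zero_of_le_nonneg)
qed

end

theorem theorem3p3:
  fixes G :: "('g, 'm) monoid_scheme"
    and H :: "'g set"
    and X :: "'x topology"
    and \<alpha> :: "'g \<Rightarrow> 'x \<Rightarrow> 'x"
    and s :: "'g set \<Rightarrow> 'g"
  assumes "group G"
    and "countable (carrier G)"
    and "infinite (carrier G)"
    and "subgroup H G"
    and "tds X (G\<lparr>carrier := H\<rparr>) \<alpha>"
    and "coset_section G H s"
    and "finite (rcosets\<^bsub>G\<^esub> H)"
  shows "null_system (coind_space G H X) G (coind_action G H s X \<alpha>)
     \<longleftrightarrow> null_system X (G\<lparr>carrier := H\<rparr>) \<alpha>"
proof -
  interpret coinduced_system G H X \<alpha> s
    using assms by (intro coinduced_system.intro coinduced_system_axioms.intro)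
  show ?thesis
    using null_coinduced_imp_null null_imp_null_coinduced[OF assms(7)] by blast
qed

end
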